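(* Let $J=\langle u_1,\dots,u_r\rangle$ be a squarefree monomial ideal of $S=\mathsf{k}[X_1,\dots,X_n]$ generated in degree $n-2$, with minimal monomial generators $u_1,\dots,u_r$, and let $K\subset R=S[T_1,\dots,T_r]$ be the defining ideal of the Rees algebra of $J$. Then $$K=RK_1+R\left(\bigcup_{s=2}^{\infty}P_s\right),$$ where, for $s\ge 2$, $$P_s=\{T_\alpha-T_\beta:\ u_\alpha=u_\beta \text{ for some } \alpha,\beta\in J_s\}.$$
   Context: $\mathsf{k}$ is a field and $S=\mathsf{k}[X_1,\dots,X_n]$ is the polynomial ring with standard grading. "Generated in degree $n-2$" means that all minimal monomial generators of $J$ have degree $n-2$. The Rees algebra of $J=\langle u_1,\dots,u_r\rangle$ is $\mathcal{R}(J)=\bigoplus_{s\ge 0}J^st^s=S[Jt]\subset S[t]$. Let $R=S[T_1,\dots,T_r]$ and let $\phi:R\to\mathcal{R}(J)$ be the surjective ring homomorphism with $\phi(X_i)=X_i$ (and $\phi$ the identity on $\mathsf{k}$) and $\phi(T_j)=u_jt$. The ideal $K=\ker(\phi)$ is called the defining ideal of the Rees algebra. One has $K=\bigoplus_{i\ge 1}K_i$, where $K_i$ is the homogeneous component of $K$ of degree $i$ in the variables $T_1,\dots,T_r$. $J_s$ denotes the set of all non-decreasing sequences $\alpha=(i_1,\dots,i_s)$ of length $s$ with entries in $\{1,\dots,r\}$. For such $\alpha$, $u_\alpha=u_{i_1}u_{i_2}\cdots u_{i_s}$ and $T_\alpha=T_{i_1}T_{i_2}\cdots T_{i_s}$.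 *)

theory Defs
  imports
    "HOL-Library.Poly_Mapping"
    "HOL-Computational_Algebra.Polynomial"
    "HOL-Algebra.Ideal_Product"
begin

text \<open>
  Multivariate polynomials are finitely supported functions from exponent vectors to
  coefficients, so \<open>'a mpoly\<close> has variables indexed by all of \<open>nat\<close>. The rings in \<open>n\<close>
  (respectively \<open>r\<close>) variables are carved out as \<open>HOL-Algebra\<close> ring records on a subset of the
  type, with variables indexed by \<open>{1..n}\<close>.
\<close>

type_synonym 'a mpoly = "(nat \<Rightarrow>\<^sub>0 nat) \<Rightarrow>\<^sub>0 'a"

definition ring_on :: "'a::comm_ring_1 set \<Rightarrow> 'a ring" where
  "ring_on C = \<lparr>carrier = C, monoid.mult = (*), one = 1, ring.zero = 0, add = (+)\<rparr>"

definition exp_deg :: "(nat \<Rightarrow>\<^sub>0 nat) \<Rightarrow> nat" where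
  "exp_deg m = (\<Sum>i\<in>Poly_Mapping.keys m. Poly_Mapping.lookup m i)"

text \<open>
  The degree is an integer so that \<open>n - 2\<close> is not truncated.
\<close>

definition homogeneous :: "int \<Rightarrow> 'a::zero mpoly \<Rightarrow> bool" where
  "homogeneous d p \<longleftrightarrow> (\<forall>m\<in>Poly_Mapping.keys p. int (exp_deg m) = d)"


subsection \<open>The ring \<open>S = k[X\<^sub>1, \<dots>, X\<^sub>n]\<close> and its monomial ideals\<close>

definition S_ring :: "nat \<Rightarrow> 'k::field mpoly ring" where
  "S_ring n = ring_on {p. \<forall>m\<in>Poly_Mapping.keys p. Poly_Mapping.keys m \<subseteq> {1..n}}"

definition monomials :: "nat \<Rightarrow> 'k::field mpoly set" where
  "monomials n = {Poly_Mapping.single m 1 | m. Poly_Mapping.keys m \<subseteq> {1..n}}"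

definition squarefree_monomials :: "nat \<Rightarrow> 'k::field mpoly set" where
  "squarefree_monomials n = {Poly_Mapping.single m 1 | m.
     Poly_Mapping.keys m \<subseteq> {1..n} \<and> (\<forall>i. Poly_Mapping.lookup m i \<le> 1)}"

definition squarefree_monomial_ideal :: "nat \<Rightarrow> 'k::field mpoly set \<Rightarrow> bool" where
  "squarefree_monomial_ideal n J \<longleftrightarrow>
     (\<exists>A. A \<subseteq> squarefree_monomials n \<and> J = Idl\<^bsub>S_ring n\<^esub> A)"

text \<open>
  A monomial ideal has exactly one generating set of monomials that is minimal under inclusion;
  its elements are the minimal monomial generators.
\<close>

definition minimal_monomial_generators :: "nat \<Rightarrow> 'k::field mpoly set \<Rightarrow> 'k mpoly set \<Rightarrow> bool" where
  "minimal_monomial_generators n J G \<longleftrightarrow>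
     G \<subseteq> monomials n \<and> Idl\<^bsub>S_ring n\<^esub> G = J \<and> (\<forall>H. H \<subset> G \<longrightarrow> Idl\<^bsub>S_ring n\<^esub> H \<noteq> J)"


subsection \<open>The Rees algebra and its defining ideal\<close>

text \<open>
  \<open>S[t]\<close> is modelled by the type \<open>'k mpoly poly\<close>. The powers of \<open>J\<close> are taken in the
  multiplicative monoid of ideals of \<open>S\<close>, whose unit is \<open>S\<close> itself, so \<open>J\<close> to the power \<open>0\<close> is \<open>S\<close>.
\<close>

definition rees_algebra :: "nat \<Rightarrow> 'k::field mpoly set \<Rightarrow> 'k mpoly poly ring" where
  "rees_algebra n J =
     ring_on {f. \<forall>s. Polynomial.coeff f s \<in> J [^]\<^bsub>ideals_set (S_ring n)\<^esub> (s::nat)}"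

text \<open>
  \<open>R = S[T\<^sub>1, \<dots>, T\<^sub>r]\<close>: the outer exponent vectors are those of the variables \<open>T\<^sub>j\<close>, so
  \<^const>\<open>exp_deg\<close> and \<^const>\<open>homogeneous\<close> refer to the degree in \<open>T\<^sub>1, \<dots>, T\<^sub>r\<close> on this ring.
\<close>

definition R_ring :: "nat \<Rightarrow> nat \<Rightarrow> 'k::field mpoly mpoly ring" where
  "R_ring n r = ring_on {P. \<forall>m\<in>Poly_Mapping.keys P.
     Poly_Mapping.keys m \<subseteq> {1..r} \<and> Poly_Mapping.lookup P m \<in> carrier (S_ring n)}"

definition T_var :: "nat \<Rightarrow> 'k::field mpoly mpoly" where
  "T_var j = Poly_Mapping.single (Poly_Mapping.single j 1) 1"

text \<open>
  The \<open>S\<close>-algebra homomorphism with \<open>T\<^sub>j \<mapsto> u\<^sub>j t\<close>, as the evaluation of a polynomial in the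
  \<open>T\<^sub>j\<close> at the elements \<open>u\<^sub>j t\<close> of \<open>S[t]\<close>.
\<close>

definition rees_map :: "(nat \<Rightarrow> 'k::field mpoly) \<Rightarrow> 'k mpoly mpoly \<Rightarrow> 'k mpoly poly" where
  "rees_map u P = (\<Sum>m\<in>Poly_Mapping.keys P.
     [:Poly_Mapping.lookup P m:] *
     (\<Prod>j\<in>Poly_Mapping.keys m. Polynomial.monom (u j) 1 ^ Poly_Mapping.lookup m j))"

lemma rees_map_const: "rees_map u (Poly_Mapping.single 0 c) = [:c:]"
  by (cases "c = 0") (simp_all add: rees_map_def)

lemma rees_map_T_var: "rees_map u (T_var j) = Polynomial.monom (u j) 1"
  by (simp add: rees_map_def T_var_def flip: one_pCons)

definition rees_ideal ::
    "nat \<Rightarrow> nat \<Rightarrow> 'k::field mpoly set \<Rightarrow> (nat \<Rightarrow> 'k mpoly) \<Rightarrow> 'k mpoly mpoly set" where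
  "rees_ideal n r J u = a_kernel (R_ring n r) (rees_algebra n J) (rees_map u)"

definition rees_component ::
    "nat \<Rightarrow> nat \<Rightarrow> 'k::field mpoly set \<Rightarrow> (nat \<Rightarrow> 'k mpoly) \<Rightarrow> nat \<Rightarrow> 'k mpoly mpoly set" where
  "rees_component n r J u i = {P \<in> rees_ideal n r J u. homogeneous (int i) P}"


subsection \<open>The binomials \<open>T\<^sub>\<alpha> - T\<^sub>\<beta>\<close>\<close>

definition index_seqs :: "nat \<Rightarrow> nat \<Rightarrow> nat list set" where
  "index_seqs r s = {\<alpha>. length \<alpha> = s \<and> sorted \<alpha> \<and> set \<alpha> \<subseteq> {1..r}}"

definition u_seq :: "(nat \<Rightarrow> 'k::field mpoly) \<Rightarrow> nat list \<Rightarrow> 'k mpoly" where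
  "u_seq u \<alpha> = prod_list (map u \<alpha>)"

definition T_seq :: "nat list \<Rightarrow> 'k::field mpoly mpoly" where
  "T_seq \<alpha> = prod_list (map T_var \<alpha>)"

definition P_set :: "nat \<Rightarrow> (nat \<Rightarrow> 'k::field mpoly) \<Rightarrow> nat \<Rightarrow> 'k mpoly mpoly set" where
  "P_set r u s = {T_seq \<alpha> - T_seq \<beta> | \<alpha> \<beta>.
     \<alpha> \<in> index_seqs r s \<and> \<beta> \<in> index_seqs r s \<and> u_seq u \<alpha> = u_seq u \<beta>}"

end

theory Submission
  imports Defs "HOL-Library.Multiset"
begin

text \<open>
  Write \<open>u\<^sub>j = X^(v\<^sub>j)\<close>. As \<open>u\<^sub>j\<close> is squarefree of degree \<open>n - 2\<close>, it misses exactly two of the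
  variables, so the generators are the edges of a simple graph on \<open>{1..n}\<close>: the edge of \<open>u\<^sub>j\<close>
  consists of the two variables that do not divide it.

  The Rees map sends the monomial \<open>X\<^sup>a T\<^sub>\<alpha>\<close> to \<open>X\<^sup>a u\<^sub>\<alpha> t\<^sup>s\<close> with \<open>s\<close> the length of \<open>\<alpha>\<close>, so it maps monomials to
  monomials and its kernel is spanned over the field by the binomials \<open>X\<^sup>a T\<^sub>\<alpha> - X\<^sup>b T\<^sub>\<beta>\<close> with \<open>\<alpha>\<close>, \<open>\<beta>\<close> of
  equal length and \<open>X\<^sup>a u\<^sub>\<alpha> = X\<^sup>b u\<^sub>\<beta>\<close> (this is \<open>weighted_sum_mem_ideal\<close>, used in
  \<open>rees_ideal_subset\<close>). Each such binomial is reduced to the linear and the fiber relations by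
  induction on the length (\<open>binomial_mem\<close>). If \<open>a = b\<close>, it is a multiple of \<open>T\<^sub>\<alpha> - T\<^sub>\<beta>\<close> with
  \<open>u\<^sub>\<alpha> = u\<^sub>\<beta>\<close>. Otherwise there are \<open>i\<close> in \<open>\<alpha>\<close> and \<open>j\<close> in \<open>\<beta>\<close> such that \<open>u\<^sub>j\<close> divides \<open>X\<^sup>a u\<^sub>i\<close>, say
  \<open>X\<^sup>a u\<^sub>i = X\<^sup>c u\<^sub>j\<close>. Modulo the linear relation \<open>X\<^sup>a T\<^sub>i - X\<^sup>c T\<^sub>j\<close>, the factor \<open>T\<^sub>i\<close> of \<open>X\<^sup>a T\<^sub>\<alpha>\<close> can
  be replaced by \<open>T\<^sub>j\<close>, which is then a common factor of both terms and can be split off.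

  The existence of \<open>i\<close> and \<open>j\<close> (\<open>exchange_divides\<close>) is where it matters that each generator
  misses only two variables. As all \<open>u\<^sub>j\<close> have the same degree, so have \<open>X\<^sup>a\<close> and \<open>X\<^sup>b\<close>, and \<open>a \<noteq> b\<close> gives a
  vertex \<open>y\<close> at which \<open>a\<close> exceeds \<open>b\<close>. Comparing the exponents of \<open>y\<close>, more edges of \<open>\<alpha>\<close> than of
  \<open>\<beta>\<close> contain \<open>y\<close>; let \<open>i\<close> be one of them and \<open>x\<close> its other end. If \<open>x\<close> lies on an edge \<open>j\<close> of
  \<open>\<beta>\<close>, then \<open>u\<^sub>j\<close> divides \<open>X\<^sub>y u\<^sub>i\<close>. If not, then comparing the exponents of \<open>x\<close> shows that
  \<open>X\<^sub>x X\<^sub>y\<close> divides \<open>X\<^sup>a\<close>, so \<open>X\<^sup>a u\<^sub>i\<close> is divisible by every variable and hence by every \<open>u\<^sub>j\<close>.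
\<close>

section \<open>Exponent vectors\<close>

lemma lookup_sum_mset:
  "Poly_Mapping.lookup (\<Sum>j\<in>#M. f j) x = (\<Sum>j\<in>#M. Poly_Mapping.lookup (f j) x)"
  by (induction M) (simp_all add: lookup_add)

lemma exp_deg_add: "exp_deg (a + b) = exp_deg a + exp_deg b"
  unfolding exp_deg_def by (rule setsum_keys_plus_distrib) simp_all

lemma exp_deg_sum_mset: "exp_deg (\<Sum>j\<in>#M. f j) = (\<Sum>j\<in>#M. exp_deg (f j))"
  by (induction M) (simp_all add: exp_deg_add, simp add: exp_deg_def)

lemma exp_deg_eq_0_iff: "exp_deg a = 0 \<longleftrightarrow> a = 0"
  by (simp add: exp_deg_def in_keys_iff poly_mapping_eq_iff fun_eq_iff)

lemma exp_le_imp_add: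
  fixes a b :: "nat \<Rightarrow>\<^sub>0 nat"
  assumes "\<And>x. Poly_Mapping.lookup a x \<le> Poly_Mapping.lookup b x"
  obtains c where "b = a + c"
proof
  show "b = a + (b - a)"
    using assms by (simp add: poly_mapping_eq_iff fun_eq_iff lookup_add lookup_minus)
qed

section \<open>The exchange property of squarefree monomials missing two variables\<close>

lemma exists_other_missing_vertex:
  fixes w :: "nat \<Rightarrow>\<^sub>0 nat"
  assumes keys: "Poly_Mapping.keys w \<subseteq> {1..n}" and sf: "\<And>z. Poly_Mapping.lookup w z \<le> 1"
    and deg: "int (exp_deg w) = int n - 2"
    and y: "y \<in> {1..n}" "Poly_Mapping.lookup w y = 0"
  obtains x where "x \<noteq> y" "Poly_Mapping.lookup w x = 0"
    "\<And>z. z \<in> {1..n} \<Longrightarrow> z \<noteq> x \<Longrightarrow> z \<noteq> y \<Longrightarrow> Poly_Mapping.lookup w z = 1"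
proof -
  have "exp_deg w = (\<Sum>i\<in>Poly_Mapping.keys w. 1)"
    unfolding exp_deg_def
  proof (rule sum.cong)
    show "Poly_Mapping.lookup w i = 1" if "i \<in> Poly_Mapping.keys w" for i
      using that sf[of i] by (simp add: in_keys_iff)
  qed simp
  then have "card (Poly_Mapping.keys w) + 2 = n" using deg by simp
  then have "card ({1..n} - Poly_Mapping.keys w) = 2"
    using keys by (simp add: card_Diff_subset)
  then have "\<exists>x. x \<noteq> y \<and> {1..n} - Poly_Mapping.keys w = {y, x}"
  proof -
    have "y \<in> {1..n} - Poly_Mapping.keys w" using y by (simp add: in_keys_iff)
    then show ?thesis using \<open>card _ = 2\<close> unfolding card_2_iff
      by (metis doubleton_eq_iff empty_iff insert_iff)
  qed
  then obtain x where x: "x \<noteq> y" "{1..n} - Poly_Mapping.keys w = {y, x}" by blast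
  show ?thesis
  proof (rule that[OF x(1)])
    show "Poly_Mapping.lookup w x = 0" using x(2) by (auto simp: in_keys_iff)
    show "Poly_Mapping.lookup w z = 1" if "z \<in> {1..n}" "z \<noteq> x" "z \<noteq> y" for z
    proof -
      have "z \<in> Poly_Mapping.keys w" using that x(2) by blast
      then show ?thesis using sf[of z] by (simp add: in_keys_iff)
    qed
  qed
qed

lemma sum_mset_le_size:
  fixes f :: "'a \<Rightarrow> nat"
  assumes "\<And>j. j \<in># M \<Longrightarrow> f j \<le> 1"
  shows "(\<Sum>j\<in>#M. f j) \<le> size M"
  using assms by (induction M) fastforce+

lemma sum_mset_eq_size:
  fixes f :: "'a \<Rightarrow> nat"
  assumes "\<And>j. j \<in># M \<Longrightarrow> f j = 1"
  shows "(\<Sum>j\<in>#M. f j) = size M"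
  using assms by (induction M) auto

text \<open>
  In terms of edges: the exponent of \<open>x\<close> in \<open>X\<^sup>a u\<^sub>\<alpha>\<close> is \<open>a x\<close> plus the number of edges of \<open>\<alpha>\<close> that
  avoid \<open>x\<close>. An edge \<open>i\<close> of \<open>\<alpha>\<close> through a vertex \<open>y\<close> where \<open>a\<close> is larger can be traded for an edge of
  \<open>\<beta>\<close> that shares the other end of \<open>i\<close>, or for any edge if \<open>X\<^sup>a\<close> is divisible by both ends of \<open>i\<close>.
\<close>
lemma exchange_divides:
  fixes v :: "'i \<Rightarrow> nat \<Rightarrow>\<^sub>0 nat"
  assumes keys: "\<And>j. j \<in># \<alpha> + \<beta> \<Longrightarrow> Poly_Mapping.keys (v j) \<subseteq> {1..n}"
    and sf: "\<And>j z. j \<in># \<alpha> + \<beta> \<Longrightarrow> Poly_Mapping.lookup (v j) z \<le> 1"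
    and deg: "\<And>j. j \<in># \<alpha> + \<beta> \<Longrightarrow> int (exp_deg (v j)) = int n - 2"
    and size: "size \<alpha> = size \<beta>"
    and eq: "a + (\<Sum>j\<in>#\<alpha>. v j) = b + (\<Sum>j\<in>#\<beta>. v j)"
    and ne: "a \<noteq> b"
  obtains i j c where "i \<in># \<alpha>" "j \<in># \<beta>" "a + v i = c + v j"
proof -
  have eqx: "Poly_Mapping.lookup a x + (\<Sum>j\<in>#\<alpha>. Poly_Mapping.lookup (v j) x) =
      Poly_Mapping.lookup b x + (\<Sum>j\<in>#\<beta>. Poly_Mapping.lookup (v j) x)" for x
    using arg_cong[OF eq, of "\<lambda>m. Poly_Mapping.lookup m x"] by (simp add: lookup_add lookup_sum_mset)
  have const: "(\<Sum>j\<in>#M. exp_deg (v j)) = size M * (n - 2)" if "set_mset M \<subseteq> set_mset (\<alpha> + \<beta>)" for M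
    using that
  proof (induction M)
    case (add j M)
    have "exp_deg (v j) = n - 2" using add.prems deg[of j] by simp
    then show ?case using add by simp
  qed simp
  have dega: "exp_deg a = exp_deg b"
    using arg_cong[OF eq, of exp_deg] const[of \<alpha>] const[of \<beta>] size
    by (simp add: exp_deg_add exp_deg_sum_mset)
  have "\<exists>y. Poly_Mapping.lookup b y < Poly_Mapping.lookup a y"
  proof (rule ccontr)
    assume "\<not> ?thesis"
    then obtain c where c: "b = a + c"
      by (meson exp_le_imp_add not_less)
    then have "c = 0" using dega by (simp add: exp_deg_add exp_deg_eq_0_iff)
    then show False using c ne by simp
  qed
  then obtain y where y: "Poly_Mapping.lookup b y < Poly_Mapping.lookup a y" ..
  have lt: "(\<Sum>j\<in>#\<alpha>. Poly_Mapping.lookup (v j) y) < (\<Sum>j\<in>#\<beta>. Poly_Mapping.lookup (v j) y)"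
    using y eqx[of y] by simp
  also have "\<dots> \<le> size \<alpha>"
    using sum_mset_le_size[of \<beta> "\<lambda>j. Poly_Mapping.lookup (v j) y"] sf size by simp
  finally have "\<exists>i\<in>#\<alpha>. Poly_Mapping.lookup (v i) y \<noteq> 1"
    using sum_mset_eq_size[of \<alpha> "\<lambda>j. Poly_Mapping.lookup (v j) y"] by fastforce
  then obtain i where i: "i \<in># \<alpha>" "Poly_Mapping.lookup (v i) y \<noteq> 1" by blast
  then have iy: "Poly_Mapping.lookup (v i) y = 0" using sf[of i y] by simp
  have "\<exists>j\<in>#\<beta>. Poly_Mapping.lookup (v j) y \<noteq> 0"
  proof (rule ccontr)
    assume "\<not> ?thesis"
    then have "(\<Sum>j\<in>#\<beta>. Poly_Mapping.lookup (v j) y) = 0" by simp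
    then show False using lt by linarith
  qed
  then obtain k where k: "k \<in># \<beta>" "Poly_Mapping.lookup (v k) y \<noteq> 0" by blast
  then have yn: "y \<in> {1..n}" using keys[of k] by (meson in_keys_iff subsetD union_iff)
  have "i \<in># \<alpha> + \<beta>" using i by simp
  then obtain x where x: "x \<noteq> y" "Poly_Mapping.lookup (v i) x = 0"
    and others: "\<And>z. z \<in> {1..n} \<Longrightarrow> z \<noteq> x \<Longrightarrow> z \<noteq> y \<Longrightarrow> Poly_Mapping.lookup (v i) z = 1"
    using exists_other_missing_vertex[OF keys sf deg yn iy] by blast
  \<comment> \<open>The variables other than \<open>x\<close> cause no trouble: \<open>u\<^sub>i\<close> misses only \<open>x\<close> and \<open>y\<close>, and \<open>X\<^sub>y\<close> divides \<open>X\<^sup>a\<close>.\<close>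
  have "\<exists>j\<in>#\<beta>. Poly_Mapping.lookup (v j) x \<le> Poly_Mapping.lookup a x"
  proof (cases "\<exists>j\<in>#\<beta>. Poly_Mapping.lookup (v j) x = 0")
    case False
    then have "Poly_Mapping.lookup (v j) x = 1" if "j \<in># \<beta>" for j
      using that sf[of j x] by (cases "Poly_Mapping.lookup (v j) x") auto
    then have b: "(\<Sum>j\<in>#\<beta>. Poly_Mapping.lookup (v j) x) = size \<beta>"
      by (rule sum_mset_eq_size)
    obtain \<alpha>' where \<alpha>': "\<alpha> = add_mset i \<alpha>'" using i by (meson mset_add)
    have "(\<Sum>j\<in>#\<alpha>'. Poly_Mapping.lookup (v j) x) \<le> size \<alpha>'"
      using sf by (intro sum_mset_le_size) (simp add: \<alpha>')
    then have "1 \<le> Poly_Mapping.lookup a x"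
      using eqx[of x] b size x by (simp add: \<alpha>')
    then show ?thesis using k(1) sf[of k x] by (intro bexI[of _ k]) auto
  next
    case True
    then show ?thesis by (metis le0)
  qed
  then obtain j where j: "j \<in># \<beta>" "Poly_Mapping.lookup (v j) x \<le> Poly_Mapping.lookup a x" by blast
  have "Poly_Mapping.lookup (v j) z \<le> Poly_Mapping.lookup (a + v i) z" for z
  proof -
    have *: "Poly_Mapping.lookup (v j) z \<le> 1" using j sf by simp
    consider "z = x" | "z = y" | "z \<in> {1..n}" "z \<noteq> x" "z \<noteq> y" | "z \<notin> {1..n}" by blast
    then show ?thesis
    proof cases
      case 4
      then have "Poly_Mapping.lookup (v j) z = 0" using keys[of j] j by (meson in_keys_iff subsetD union_iff)
      then show ?thesis by simp
    qed (use j * y others in \<open>auto simp: lookup_add\<close>)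
  qed
  then obtain c where "a + v i = v j + c" by (rule exp_le_imp_add)
  then show ?thesis using that i j by (simp add: add.commute)
qed

section \<open>Rings and ideals on a subset of a type\<close>

definition ring_closed :: "'a::comm_ring_1 set \<Rightarrow> bool" where
  "ring_closed C \<longleftrightarrow> 0 \<in> C \<and> 1 \<in> C \<and> (\<forall>x\<in>C. \<forall>y\<in>C. x + y \<in> C \<and> x * y \<in> C \<and> - x \<in> C)"

lemma ring_closedD:
  assumes "ring_closed C"
  shows "0 \<in> C" "1 \<in> C" "x \<in> C \<Longrightarrow> y \<in> C \<Longrightarrow> x + y \<in> C"
    "x \<in> C \<Longrightarrow> y \<in> C \<Longrightarrow> x * y \<in> C" "x \<in> C \<Longrightarrow> - x \<in> C"
    "x \<in> C \<Longrightarrow> y \<in> C \<Longrightarrow> x - y \<in> C"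
proof -
  show "x - y \<in> C" if "x \<in> C" "y \<in> C"
    unfolding diff_conv_add_uminus using assms that unfolding ring_closed_def by blast
qed (use assms in \<open>simp_all add: ring_closed_def\<close>)

lemma cring_ring_on:
  assumes "ring_closed C"
  shows "cring (ring_on C)"
proof (rule cringI)
  show "abelian_group (ring_on C)"
  proof (rule abelian_groupI)
    show "\<exists>y\<in>carrier (ring_on C). y \<oplus>\<^bsub>ring_on C\<^esub> x = \<zero>\<^bsub>ring_on C\<^esub>"
      if "x \<in> carrier (ring_on C)" for x
      using assms that by (intro bexI[of _ "- x"]) (auto simp: ring_on_def ring_closed_def)
  qed (use assms in \<open>auto simp: ring_on_def ring_closed_def algebra_simps\<close>)
  show "comm_monoid (ring_on C)"
    by (rule comm_monoidI) (use assms in \<open>auto simp: ring_on_def ring_closed_def algebra_simps\<close>)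
qed (auto simp: ring_on_def algebra_simps)

lemma ideal_ring_onI:
  assumes "ring_closed C" "I \<subseteq> C" "0 \<in> I"
    and "\<And>x y. x \<in> I \<Longrightarrow> y \<in> I \<Longrightarrow> x + y \<in> I"
    and "\<And>c x. c \<in> C \<Longrightarrow> x \<in> I \<Longrightarrow> c * x \<in> I"
  shows "ideal I (ring_on C)"
proof -
  interpret cring "ring_on C" by (rule cring_ring_on) fact
  have minus: "\<ominus>\<^bsub>ring_on C\<^esub> x = - x" if "x \<in> C" for x
    by (rule sum_zero_eq_neg[symmetric]) (use assms that in \<open>auto simp: ring_on_def ring_closed_def\<close>)
  have neg1: "- 1 \<in> C" using assms(1) by (auto simp: ring_closed_def)
  show ?thesis
  proof (rule idealI)
    show "subgroup I (add_monoid (ring_on C))"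
    proof (rule add.subgroupI)
      show "\<ominus>\<^bsub>ring_on C\<^esub> x \<in> I" if "x \<in> I" for x
        using assms(5)[OF neg1 that] minus[of x] that assms(2) by auto
    qed (use assms in \<open>auto simp: ring_on_def\<close>)
    show "a \<otimes>\<^bsub>ring_on C\<^esub> x \<in> I" if "a \<in> I" "x \<in> carrier (ring_on C)" for a x
      using assms(5)[of x a] that by (simp add: ring_on_def mult.commute)
  qed (use assms ring_axioms in \<open>auto simp: ring_on_def\<close>)
qed

lemma ideal_ring_onD:
  assumes "ideal I (ring_on C)"
  shows "I \<subseteq> C" "0 \<in> I" "x \<in> I \<Longrightarrow> y \<in> I \<Longrightarrow> x + y \<in> I"
    "c \<in> C \<Longrightarrow> x \<in> I \<Longrightarrow> c * x \<in> I"
proof -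
  interpret ideal I "ring_on C" by fact
  show "I \<subseteq> C" using Icarr by (auto simp: ring_on_def)
  show "0 \<in> I" using additive_subgroup.zero_closed[OF is_additive_subgroup] by (simp add: ring_on_def)
  show "x \<in> I \<Longrightarrow> y \<in> I \<Longrightarrow> x + y \<in> I" using additive_subgroup.a_closed[OF is_additive_subgroup] by (simp add: ring_on_def)
  show "c \<in> C \<Longrightarrow> x \<in> I \<Longrightarrow> c * x \<in> I" using I_l_closed by (simp add: ring_on_def)
qed

lemma poly_mapping_eq_sum_single:
  "p = (\<Sum>m\<in>Poly_Mapping.keys p. Poly_Mapping.single m (Poly_Mapping.lookup p m))"
proof (rule poly_mapping_eqI)
  fix k
  have "Poly_Mapping.lookup (\<Sum>m\<in>Poly_Mapping.keys p. Poly_Mapping.single m (Poly_Mapping.lookup p m)) k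
      = (\<Sum>m\<in>Poly_Mapping.keys p. if m = k then Poly_Mapping.lookup p m else 0)"
    by (simp add: lookup_sum lookup_single when_def)
  then show "Poly_Mapping.lookup p k = Poly_Mapping.lookup (\<Sum>m\<in>Poly_Mapping.keys p. Poly_Mapping.single m (Poly_Mapping.lookup p m)) k"
    by (simp add: in_keys_iff)
qed

lemma mult_eq_sum_single:
  fixes p q :: "'a::comm_ring_1 mpoly"
  shows "p * q = (\<Sum>m\<in>Poly_Mapping.keys p. \<Sum>l\<in>Poly_Mapping.keys q.
    Poly_Mapping.single (m + l) (Poly_Mapping.lookup p m * Poly_Mapping.lookup q l))"
  using arg_cong2[OF poly_mapping_eq_sum_single[of p] poly_mapping_eq_sum_single[of q], of "(*)"]
  by (simp only: sum_product mult_single)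

definition mpolys_over :: "nat set \<Rightarrow> 'a::comm_ring_1 set \<Rightarrow> 'a mpoly set" where
  "mpolys_over V D = {P. \<forall>m\<in>Poly_Mapping.keys P. Poly_Mapping.keys m \<subseteq> V \<and> Poly_Mapping.lookup P m \<in> D}"

text \<open>
  Stated over an arbitrary closed set of coefficients so that it can be iterated: \<open>S\<close> arises from
  the field, and \<open>R\<close> from \<open>S\<close>.
\<close>
lemma ring_closed_mpolys_over:
  assumes D: "ring_closed D"
  shows "ring_closed (mpolys_over V D)"
proof -
  let ?C = "mpolys_over V D"
  have mem: "P \<in> ?C \<longleftrightarrow> (\<forall>m. Poly_Mapping.lookup P m \<in> D \<and> (Poly_Mapping.lookup P m \<noteq> 0 \<longrightarrow> Poly_Mapping.keys m \<subseteq> V))" for P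
    using D by (force simp: mpolys_over_def in_keys_iff ring_closed_def)
  have add: "P + Q \<in> ?C" if "P \<in> ?C" "Q \<in> ?C" for P Q
  proof -
    have "Poly_Mapping.keys m \<subseteq> V" if "Poly_Mapping.lookup P m + Poly_Mapping.lookup Q m \<noteq> 0" for m
      using that \<open>P \<in> ?C\<close> \<open>Q \<in> ?C\<close> unfolding mem by (metis add_0)
    then show ?thesis using that D unfolding mem lookup_add ring_closed_def by blast
  qed
  have sum: "sum f A \<in> ?C" if "\<And>a. a \<in> A \<Longrightarrow> f a \<in> ?C" for f and A :: "(nat \<Rightarrow>\<^sub>0 nat) set"
    using that
    by (induction A rule: infinite_finite_induct) (auto intro: add, auto simp: mpolys_over_def)
  have single: "Poly_Mapping.single m c \<in> ?C" if "Poly_Mapping.keys m \<subseteq> V" "c \<in> D" for m c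
    using that D unfolding mem by (auto simp: lookup_single when_def ring_closed_def)
  have mult: "P * Q \<in> ?C" if "P \<in> ?C" "Q \<in> ?C" for P Q
    unfolding mult_eq_sum_single[of P Q]
  proof (intro sum single)
    fix m l assume ml: "m \<in> Poly_Mapping.keys P" "l \<in> Poly_Mapping.keys Q"
    then show "Poly_Mapping.keys (m + l) \<subseteq> V"
      using that keys_add[of m l] unfolding mpolys_over_def by blast
    show "Poly_Mapping.lookup P m * Poly_Mapping.lookup Q l \<in> D"
      using that D ml unfolding mpolys_over_def ring_closed_def by blast
  qed
  have "- P \<in> ?C" if "P \<in> ?C" for P
    using that D unfolding mem by (auto simp: ring_closed_def)
  moreover have "1 \<in> ?C" using D by (auto simp: mpolys_over_def ring_closed_def simp flip: single_one)
  moreover have "0 \<in> ?C" by (simp add: mpolys_over_def)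
  ultimately show ?thesis using add mult by (simp add: ring_closed_def)
qed

lemma S_ring_eq: "S_ring n = ring_on (mpolys_over {1..n} UNIV)"
  by (simp add: S_ring_def mpolys_over_def)

lemma R_ring_eq: "R_ring n r = ring_on (mpolys_over {1..r} (mpolys_over {1..n} UNIV))"
  by (simp add: R_ring_def S_ring_eq mpolys_over_def ring_on_def)

lemma ring_closed_UNIV: "ring_closed UNIV" by (simp add: ring_closed_def)

section \<open>Monomial ideals\<close>

text \<open>
  The polynomials all of whose monomials are divisible by an element of \<open>G\<close> form an ideal that
  contains \<open>G\<close>.
\<close>
lemma monomial_mem_ideal_imp_divisible:
  assumes G: "G \<subseteq> monomials n" and m: "Poly_Mapping.single m (1::'k::field) \<in> Idl\<^bsub>S_ring n\<^esub> G"
  obtains p q where "Poly_Mapping.single p 1 \<in> G" "m = p + q"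
proof -
  let ?C = "mpolys_over {1..n} (UNIV :: 'k set)"
  have C: "ring_closed ?C" by (intro ring_closed_mpolys_over ring_closed_UNIV)
  interpret cring "S_ring n :: 'k mpoly ring" unfolding S_ring_eq by (rule cring_ring_on[OF C])
  define D where "D = {f \<in> ?C. \<forall>m\<in>Poly_Mapping.keys f. \<exists>p q. Poly_Mapping.single p 1 \<in> G \<and> m = p + q}"
  have "ideal D (S_ring n)"
    unfolding S_ring_eq
  proof (rule ideal_ring_onI[OF C])
    show "x + y \<in> D" if "x \<in> D" "y \<in> D" for x y
    proof -
      have "x + y \<in> ?C" using that C by (simp add: D_def ring_closed_def)
      then show ?thesis using that keys_add[of x y] unfolding D_def by blast
    qed
    show "c * x \<in> D" if c: "c \<in> ?C" and x: "x \<in> D" for c x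
    proof -
      have "\<exists>p q. Poly_Mapping.single p 1 \<in> G \<and> k = p + q" if k: "k \<in> Poly_Mapping.keys (c * x)" for k
      proof -
        obtain a b where ab: "b \<in> Poly_Mapping.keys x" "k = a + b"
          using subsetD[OF keys_mult k] by blast
        then obtain p q where "Poly_Mapping.single p 1 \<in> G" "b = p + q"
          using x unfolding D_def by blast
        then show ?thesis using ab by (intro exI[of _ p] exI[of _ "a + q"]) (simp add: add.left_commute)
      qed
      moreover have "c * x \<in> ?C" using c x C by (simp add: D_def ring_closed_def)
      ultimately show ?thesis by (simp add: D_def)
    qed
  qed (use C in \<open>auto simp: D_def ring_closed_def\<close>)
  moreover have "G \<subseteq> D"
  proof
    fix g assume g: "g \<in> G"
    then obtain p where p: "g = Poly_Mapping.single p 1" "Poly_Mapping.keys p \<subseteq> {1..n}"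
      using G by (auto simp: monomials_def)
    then have "Poly_Mapping.single p 1 \<in> G \<and> p = p + 0" using g by simp
    then have "\<exists>p' q. Poly_Mapping.single p' 1 \<in> G \<and> p = p' + q" by blast
    then show "g \<in> D" using p by (simp add: D_def mpolys_over_def)
  qed
  ultimately have "Idl\<^bsub>S_ring n\<^esub> G \<subseteq> D" by (rule genideal_minimal)
  then have "Poly_Mapping.single m 1 \<in> D" using m by blast
  then show ?thesis using that unfolding D_def by auto
qed

text \<open>
  A generator \<open>u\<^sub>j\<close> is divisible by one of the squarefree monomials that define \<open>J\<close>, which in turn is
  divisible by some \<open>u\<^sub>i\<close>. As \<open>u\<^sub>i\<close> and \<open>u\<^sub>j\<close> have the same degree, both divisions are equalities.
\<close>
lemma equigenerated_generators_squarefree: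
  fixes u :: "nat \<Rightarrow> 'k::field mpoly"
  assumes sf: "squarefree_monomial_ideal n J"
    and gen: "minimal_monomial_generators n J (u ` A)"
    and hom: "\<forall>j\<in>A. homogeneous d (u j)" and j: "j \<in> A"
  shows "u j \<in> squarefree_monomials n"
proof -
  obtain B where B: "B \<subseteq> squarefree_monomials n" "J = Idl\<^bsub>S_ring n\<^esub> B"
    using sf unfolding squarefree_monomial_ideal_def by blast
  have u: "u ` A \<subseteq> monomials n" "Idl\<^bsub>S_ring n\<^esub> (u ` A) = J"
    using gen unfolding minimal_monomial_generators_def by auto
  interpret cring "S_ring n :: 'k mpoly ring"
    unfolding S_ring_eq by (intro cring_ring_on ring_closed_mpolys_over ring_closed_UNIV)
  have BM: "B \<subseteq> monomials n" using B(1) by (auto simp: squarefree_monomials_def monomials_def)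
  have MC: "monomials n \<subseteq> carrier (S_ring n :: 'k mpoly ring)"
    by (auto simp: monomials_def S_ring_def ring_on_def)
  have deg: "int (exp_deg m) = d" if "i \<in> A" "u i = Poly_Mapping.single m 1" for i m
    using that hom by (auto simp: homogeneous_def)
  obtain m where m: "u j = Poly_Mapping.single m 1" using u(1) j by (auto simp: monomials_def)
  have "u j \<in> J" using genideal_self[of "u ` A"] u MC j by blast
  then have "Poly_Mapping.single m 1 \<in> Idl\<^bsub>S_ring n\<^esub> B" using m B(2) by simp
  from monomial_mem_ideal_imp_divisible[OF BM this]
  obtain p q where p: "Poly_Mapping.single p 1 \<in> B" "m = p + q" .
  have "Poly_Mapping.single p 1 \<in> J" using p(1) genideal_self[of B] BM MC B(2) by blast
  then have "Poly_Mapping.single p 1 \<in> Idl\<^bsub>S_ring n\<^esub> (u ` A)" using u(2) by simp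
  from monomial_mem_ideal_imp_divisible[OF u(1) this]
  obtain p' q' where "Poly_Mapping.single p' 1 \<in> u ` A" and pp: "p = p' + q'" .
  then obtain i where i: "i \<in> A" "u i = Poly_Mapping.single p' 1" by (metis imageE)
  have "exp_deg m = exp_deg p'" using deg[OF j m] deg[OF i(1,2)] by simp
  then have "exp_deg (q' + q) = 0" using p(2) pp by (simp add: exp_deg_add)
  then have "q = 0" by (simp add: exp_deg_add exp_deg_eq_0_iff)
  then show ?thesis using p B(1) m by auto
qed

section \<open>The Rees map is a ring homomorphism\<close>

definition T_monomial_image :: "(nat \<Rightarrow> 'k::field mpoly) \<Rightarrow> (nat \<Rightarrow>\<^sub>0 nat) \<Rightarrow> 'k mpoly poly" where
  "T_monomial_image u m = (\<Prod>j\<in>Poly_Mapping.keys m. Polynomial.monom (u j) 1 ^ Poly_Mapping.lookup m j)"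

lemma rees_map_eq: "rees_map u P = (\<Sum>m\<in>Poly_Mapping.keys P. [:Poly_Mapping.lookup P m:] * T_monomial_image u m)"
  by (simp add: rees_map_def T_monomial_image_def)

lemma T_monomial_image_superset:
  assumes "finite A" "Poly_Mapping.keys m \<subseteq> A"
  shows "T_monomial_image u m = (\<Prod>j\<in>A. Polynomial.monom (u j) 1 ^ Poly_Mapping.lookup m j)"
  unfolding T_monomial_image_def using assms by (intro prod.mono_neutral_left) (auto simp: in_keys_iff)

lemma T_monomial_image_add: "T_monomial_image u (m + l) = T_monomial_image u m * T_monomial_image u l"
proof -
  let ?A = "Poly_Mapping.keys m \<union> Poly_Mapping.keys l"
  show ?thesis
    using keys_add[of m l]
    by (simp add: T_monomial_image_superset[of ?A] lookup_add power_add prod.distrib)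
qed

lemma rees_map_add: "rees_map u (P + Q) = rees_map u P + rees_map u Q"
  unfolding rees_map_eq
  proof (rule setsum_keys_plus_distrib)
  show "[:a + b:] * T_monomial_image u k = [:a:] * T_monomial_image u k + [:b:] * T_monomial_image u k" for a b k
    using distrib_right[of "[:a:]" "[:b:]" "T_monomial_image u k"] by simp
qed simp

lemma rees_map_zero: "rees_map u 0 = 0"
  by (simp add: rees_map_def)

lemma rees_map_sum: "rees_map u (\<Sum>a\<in>A. f a) = (\<Sum>a\<in>A. rees_map u (f a))"
  by (induction A rule: infinite_finite_induct) (simp_all add: rees_map_add rees_map_zero)

lemma rees_map_single: "rees_map u (Poly_Mapping.single m c) = [:c:] * T_monomial_image u m"
  by (cases "c = 0") (simp_all add: rees_map_eq)

lemma rees_map_mult: "rees_map u (P * Q) = rees_map u P * rees_map u Q"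
proof -
  have "rees_map u (P * Q) = (\<Sum>m\<in>Poly_Mapping.keys P. \<Sum>l\<in>Poly_Mapping.keys Q.
      ([:Poly_Mapping.lookup P m:] * T_monomial_image u m) * ([:Poly_Mapping.lookup Q l:] * T_monomial_image u l))"
    unfolding mult_eq_sum_single[of P Q] rees_map_sum rees_map_single T_monomial_image_add
    by (intro sum.cong) (simp_all add: algebra_simps)
  then show ?thesis by (simp add: rees_map_eq sum_product)
qed

lemma rees_map_one: "rees_map u 1 = 1"
  using rees_map_single[of u 0 1] by (simp add: T_monomial_image_def)

lemma rees_map_diff: "rees_map u (P - Q) = rees_map u P - rees_map u Q"
  using rees_map_add[of u "P - Q" Q] by simp

lemma rees_map_prod_mset: "rees_map u (\<Prod>j\<in>#M. f j) = (\<Prod>j\<in>#M. rees_map u (f j))"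
  by (induction M) (simp_all add: rees_map_one rees_map_mult)

lemma rees_ideal_eq:
  "rees_ideal n r J u = {P \<in> carrier (R_ring n r). rees_map u P = 0}"
  by (simp add: rees_ideal_def a_kernel_def' rees_algebra_def ring_on_def)

lemma ideal_rees_ideal: "ideal (rees_ideal n r J u) (R_ring n r)"
proof -
  have C: "ring_closed (mpolys_over {1..r} (mpolys_over {1..n} UNIV))"
    by (intro ring_closed_mpolys_over ring_closed_UNIV)
  show ?thesis
    unfolding rees_ideal_eq R_ring_eq
    using C by (intro ideal_ring_onI[OF C])
      (auto simp: ring_on_def ring_closed_def rees_map_add rees_map_mult rees_map_zero)
qed

section \<open>Monomials and their coefficients in \<open>R\<close>\<close>

lemma prod_T_var_eq_single:
  "(\<Prod>j\<in>#M. T_var j) = (Poly_Mapping.single (\<Sum>j\<in>#M. Poly_Mapping.single j 1) 1 :: 'k::field mpoly mpoly)"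
  by (induction M) (simp_all add: T_var_def mult_single)

text \<open>
  Removing a factor \<open>T\<^sub>j\<close> is easiest on multisets of indices, so exponent vectors in the \<open>T\<^sub>j\<close> and
  non-decreasing index sequences are both translated to multisets.
\<close>
definition exponent_mset :: "(nat \<Rightarrow>\<^sub>0 nat) \<Rightarrow> nat multiset" where
  "exponent_mset m = Abs_multiset (Poly_Mapping.lookup m)"

lemma count_exponent_mset: "count (exponent_mset m) = Poly_Mapping.lookup m"
  unfolding exponent_mset_def by (rule Abs_multiset_inverse) simp

lemma set_exponent_mset: "set_mset (exponent_mset m) = Poly_Mapping.keys m"
  by (auto simp: set_mset_def count_exponent_mset in_keys_iff)

lemma single_eq_prod_T_var:
  "Poly_Mapping.single m (1 :: 'k::field mpoly) = (\<Prod>j\<in>#exponent_mset m. T_var j)"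
proof -
  have *: "Poly_Mapping.lookup (\<Sum>j\<in>#M. Poly_Mapping.single j (1::nat)) x = count M x" for M and x :: nat
    by (induction M) (simp_all add: lookup_add lookup_single when_def)
  have "(\<Sum>j\<in>#exponent_mset m. Poly_Mapping.single j 1) = m"
    by (rule poly_mapping_eqI) (simp add: * count_exponent_mset del: One_nat_def)
  then show ?thesis by (simp add: prod_T_var_eq_single)
qed

text \<open>
  The monomial \<open>X\<^sup>a T\<^sub>M\<close> of \<open>R\<close>.
\<close>
definition bimonomial :: "(nat \<Rightarrow>\<^sub>0 nat) \<Rightarrow> nat multiset \<Rightarrow> 'k::field mpoly mpoly" where
  "bimonomial a M = Poly_Mapping.single 0 (Poly_Mapping.single a 1) * (\<Prod>j\<in>#M. T_var j)"

abbreviation scalar :: "'k::field \<Rightarrow> 'k mpoly mpoly" where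
  "scalar c \<equiv> Poly_Mapping.single 0 (Poly_Mapping.single 0 c)"

lemma scalar_sum: "scalar (\<Sum>i\<in>A. f i) = (\<Sum>i\<in>A. scalar (f i))"
  by (induction A rule: infinite_finite_induct) (simp_all add: single_add)

lemma eq_sum_bimonomials:
  "P = (\<Sum>(m, a)\<in>(SIGMA m:Poly_Mapping.keys P. Poly_Mapping.keys (Poly_Mapping.lookup P m)).
     scalar (Poly_Mapping.lookup (Poly_Mapping.lookup P m) a) * bimonomial a (exponent_mset m))"
proof -
  have single_sum: "Poly_Mapping.single m (sum f A) = (\<Sum>a\<in>A. Poly_Mapping.single m (f a))"
    for m :: "nat \<Rightarrow>\<^sub>0 nat" and f :: "(nat \<Rightarrow>\<^sub>0 nat) \<Rightarrow> 'a mpoly" and A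
    by (induction A rule: infinite_finite_induct) (simp_all add: single_add)
  have single_eq: "Poly_Mapping.single m (Poly_Mapping.single a c) = scalar c * bimonomial a (exponent_mset m)"
    for m a and c :: 'a
    by (simp add: bimonomial_def mult_single flip: single_eq_prod_T_var mult.assoc)
  have "P = (\<Sum>m\<in>Poly_Mapping.keys P. Poly_Mapping.single m (Poly_Mapping.lookup P m))"
    by (rule poly_mapping_eq_sum_single)
  also have "\<dots> = (\<Sum>m\<in>Poly_Mapping.keys P. \<Sum>a\<in>Poly_Mapping.keys (Poly_Mapping.lookup P m).
      Poly_Mapping.single m (Poly_Mapping.single a (Poly_Mapping.lookup (Poly_Mapping.lookup P m) a)))"
  proof (rule sum.cong)
    show "Poly_Mapping.single m (Poly_Mapping.lookup P m) = (\<Sum>a\<in>Poly_Mapping.keys (Poly_Mapping.lookup P m).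
        Poly_Mapping.single m (Poly_Mapping.single a (Poly_Mapping.lookup (Poly_Mapping.lookup P m) a)))" for m
      using arg_cong[OF poly_mapping_eq_sum_single[of "Poly_Mapping.lookup P m"], of "Poly_Mapping.single m"]
      by (simp only: single_sum)
  qed simp
  also have "\<dots> = (\<Sum>m\<in>Poly_Mapping.keys P. \<Sum>a\<in>Poly_Mapping.keys (Poly_Mapping.lookup P m).
      scalar (Poly_Mapping.lookup (Poly_Mapping.lookup P m) a) * bimonomial a (exponent_mset m))"
    by (intro sum.cong refl single_eq)
  finally show ?thesis by (simp add: sum.Sigma)
qed

lemma ideal_ring_on_sum:
  assumes "ideal I (ring_on C)" "\<And>a. a \<in> A \<Longrightarrow> f a \<in> I"
  shows "sum f A \<in> I"
  using assms(2) by (induction A rule: infinite_finite_induct)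
    (simp_all add: ideal_ring_onD[OF assms(1)])

text \<open>
  The reason why a kernel of a map taking monomials to monomials is spanned by binomials: with \<open>w i\<close>
  the image of the monomial \<open>g i\<close>, the coefficients over each image monomial cancel. Within such a
  fiber every \<open>g i\<close> may therefore be replaced by its difference to one fixed member of the fiber.
\<close>
lemma weighted_sum_mem_ideal:
  assumes I: "ideal I (ring_on C)" and C: "range scalar \<subseteq> C" and fin: "finite A"
    and zero: "\<And>q. (\<Sum>i\<in>{i \<in> A. w i = q}. c i) = 0"
    and diff: "\<And>i j. i \<in> A \<Longrightarrow> j \<in> A \<Longrightarrow> w i = w j \<Longrightarrow> g i - g j \<in> I"
  shows "(\<Sum>i\<in>A. scalar (c i) * g i) \<in> I"
proof -
  have "(\<Sum>i\<in>{i \<in> A. w i = w k}. scalar (c i) * g i) \<in> I" if k: "k \<in> A" for k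
  proof -
    let ?F = "{i \<in> A. w i = w k}"
    have "(\<Sum>i\<in>?F. scalar (c i) * (g i - g k)) = (\<Sum>i\<in>?F. scalar (c i) * g i) - scalar (\<Sum>i\<in>?F. c i) * g k"
      by (simp add: scalar_sum right_diff_distrib sum_subtractf sum_distrib_right)
    also have "\<dots> = (\<Sum>i\<in>?F. scalar (c i) * g i)" unfolding zero by simp
    finally have eq: "(\<Sum>i\<in>?F. scalar (c i) * g i) = (\<Sum>i\<in>?F. scalar (c i) * (g i - g k))" ..
    show ?thesis
      unfolding eq using diff k C
      by (intro ideal_ring_on_sum[OF I] ideal_ring_onD(4)[OF I]) auto
  qed
  then have "(\<Sum>q\<in>w ` A. \<Sum>i\<in>{i \<in> A. w i = q}. scalar (c i) * g i) \<in> I"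
    by - (rule ideal_ring_on_sum[OF I], blast)
  then show ?thesis by (simp flip: sum.image_gen[OF fin])
qed

text \<open>
  The carrier of \<open>R\<close>.
\<close>
abbreviation bipolys :: "nat \<Rightarrow> nat \<Rightarrow> 'k::field mpoly mpoly set" where
  "bipolys n r \<equiv> mpolys_over {1..r} (mpolys_over {1..n} UNIV)"

lemma ring_closed_bipolys: "ring_closed (bipolys n r)"
  by (intro ring_closed_mpolys_over ring_closed_UNIV)

lemmas bipolys_closed = ring_closedD[OF ring_closed_bipolys]

lemma T_var_mem: "j \<in> {1..r} \<Longrightarrow> T_var j \<in> bipolys n r"
  by (auto simp: T_var_def mpolys_over_def)

lemma prod_T_var_mem: "set_mset M \<subseteq> {1..r} \<Longrightarrow> (\<Prod>j\<in>#M. T_var j) \<in> bipolys n r"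
  by (induction M) (simp_all add: bipolys_closed T_var_mem del: One_nat_def)

lemma coefficient_mem: "Poly_Mapping.keys a \<subseteq> {1..n} \<Longrightarrow> Poly_Mapping.single 0 (Poly_Mapping.single a c) \<in> bipolys n r"
  by (auto simp: mpolys_over_def)

lemma bimonomial_mem:
  assumes "Poly_Mapping.keys a \<subseteq> {1..n}" "set_mset M \<subseteq> {1..r}"
  shows "bimonomial a M \<in> bipolys n r"
  unfolding bimonomial_def using assms by (intro bipolys_closed coefficient_mem prod_T_var_mem)

lemma bimonomial_add_mset: "bimonomial a (add_mset j M) = T_var j * bimonomial a M"
  by (simp add: bimonomial_def mult.left_commute)

lemma bimonomial_add_mset': "bimonomial a (add_mset j M) = (\<Prod>j\<in>#M. T_var j) * bimonomial a {#j#}"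
  by (simp add: bimonomial_def ac_simps)

lemma T_seq_sorted_list: "T_seq (sorted_list_of_multiset M) = (\<Prod>j\<in>#M. T_var j)"
  by (simp add: T_seq_def flip: prod_mset_prod_list)

lemma u_seq_sorted_list: "u_seq u (sorted_list_of_multiset M) = (\<Prod>j\<in>#M. u j)"
  by (simp add: u_seq_def flip: prod_mset_prod_list)

lemma prod_monom: "(\<Prod>j\<in>#M. Polynomial.monom (u j) 1) = Polynomial.monom (\<Prod>j\<in>#M. u j :: 'k::field mpoly) (size M)"
  by (induction M) (simp_all add: mult_monom)

lemma rees_map_prod_T_var: "rees_map u (\<Prod>j\<in>#M. T_var j) = Polynomial.monom (\<Prod>j\<in>#M. u j) (size M)"
  by (simp only: rees_map_prod_mset rees_map_T_var prod_monom)

lemma P_set_subset_rees_ideal: "P_set r u s \<subseteq> rees_ideal n r J u"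
proof
  fix p assume "p \<in> P_set r u s"
  then obtain \<alpha> \<beta> where p: "p = T_seq \<alpha> - T_seq \<beta>" and \<alpha>: "\<alpha> \<in> index_seqs r s"
    and \<beta>: "\<beta> \<in> index_seqs r s" and u: "u_seq u \<alpha> = u_seq u \<beta>"
    unfolding P_set_def by blast
  have T: "T_seq \<gamma> = (\<Prod>j\<in>#mset \<gamma>. T_var j)" for \<gamma>
    by (simp add: T_seq_def flip: prod_mset_prod_list)
  have U: "u_seq u \<gamma> = (\<Prod>j\<in>#mset \<gamma>. u j)" for \<gamma>
    by (simp add: u_seq_def flip: prod_mset_prod_list)
  have "T_seq \<alpha> \<in> bipolys n r" "T_seq \<beta> \<in> bipolys n r"
    unfolding T using \<alpha> \<beta> by (intro prod_T_var_mem; simp add: index_seqs_def)+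
  then have "p \<in> bipolys n r"
    unfolding p by (rule bipolys_closed)
  moreover have "rees_map u p = 0"
    unfolding p rees_map_diff T rees_map_prod_T_var
    using \<alpha> \<beta> u unfolding U by (simp add: index_seqs_def)
  ultimately show "p \<in> rees_ideal n r J u"
    by (simp add: rees_ideal_eq R_ring_eq ring_on_def)
qed

section \<open>Reduction to linear and fiber relations\<close>

locale codim2_monomials =
  fixes n r :: nat and u :: "nat \<Rightarrow> 'k::field mpoly" and v :: "nat \<Rightarrow> nat \<Rightarrow>\<^sub>0 nat"
  assumes u_eq: "j \<in> {1..r} \<Longrightarrow> u j = Poly_Mapping.single (v j) 1"
    and keys_v: "j \<in> {1..r} \<Longrightarrow> Poly_Mapping.keys (v j) \<subseteq> {1..n}"
    and v_le_1: "j \<in> {1..r} \<Longrightarrow> Poly_Mapping.lookup (v j) x \<le> 1"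
    and deg_v: "j \<in> {1..r} \<Longrightarrow> int (exp_deg (v j)) = int n - 2"
begin

lemma prod_u: "set_mset M \<subseteq> {1..r} \<Longrightarrow> (\<Prod>j\<in>#M. u j) = Poly_Mapping.single (\<Sum>j\<in>#M. v j) 1"
  by (induction M) (simp_all add: u_eq mult_single)

lemma rees_map_bimonomial:
  "set_mset M \<subseteq> {1..r} \<Longrightarrow>
    rees_map u (bimonomial a M) = Polynomial.monom (Poly_Mapping.single (a + (\<Sum>j\<in>#M. v j)) 1) (size M)"
  by (simp add: bimonomial_def rees_map_mult rees_map_const rees_map_prod_T_var prod_u mult_single
      smult_monom)

lemma linear_relation_mem:
  assumes ij: "i \<in> {1..r}" "j \<in> {1..r}" and a: "Poly_Mapping.keys a \<subseteq> {1..n}"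
    and eq: "a + v i = c + v j"
  shows "bimonomial a {#i#} - bimonomial c {#j#} \<in> rees_component n r J u 1"
proof -
  let ?P = "bimonomial a {#i#} - bimonomial c {#j#} :: 'k mpoly mpoly"
  have "Poly_Mapping.keys c \<subseteq> Poly_Mapping.keys (c + v j)"
    by (auto simp: in_keys_iff lookup_add)
  also have "\<dots> \<subseteq> {1..n}" unfolding eq[symmetric] using keys_add[of a "v i"] a keys_v[OF ij(1)] by blast
  finally have c: "Poly_Mapping.keys c \<subseteq> {1..n}" .
  have "?P \<in> bipolys n r"
    using a c ij by (intro bipolys_closed bimonomial_mem) simp_all
  moreover have "rees_map u ?P = 0"
    using ij eq by (simp add: rees_map_diff rees_map_bimonomial)
  moreover have "homogeneous 1 ?P"
  proof -
    have "Poly_Mapping.keys (bimonomial b {#k#} :: 'k mpoly mpoly) \<subseteq> {Poly_Mapping.single k 1}" for b k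
      by (simp add: bimonomial_def T_var_def mult_single)
    then have "Poly_Mapping.keys ?P \<subseteq> {Poly_Mapping.single i 1, Poly_Mapping.single j 1}"
      using keys_diff[of "bimonomial a {#i#} :: 'k mpoly mpoly" "bimonomial c {#j#}"] by blast
    moreover have "exp_deg (Poly_Mapping.single k 1) = 1" for k by (simp add: exp_deg_def)
    ultimately show ?thesis unfolding homogeneous_def by auto
  qed
  ultimately show ?thesis
    by (simp add: rees_component_def rees_ideal_eq R_ring_eq ring_on_def)
qed

lemma fiber_relation_mem:
  assumes "set_mset \<alpha> \<subseteq> {1..r}" "set_mset \<beta> \<subseteq> {1..r}" "size \<alpha> = size \<beta>"
    and "(\<Sum>j\<in>#\<alpha>. v j) = (\<Sum>j\<in>#\<beta>. v j)"
  shows "(\<Prod>j\<in>#\<alpha>. T_var j) - (\<Prod>j\<in>#\<beta>. T_var j) \<in> P_set r u (size \<alpha>)"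
proof -
  have mem: "sorted_list_of_multiset M \<in> index_seqs r (size M)" if "set_mset M \<subseteq> {1..r}" for M
    using that by (simp add: index_seqs_def flip: size_mset)
  show ?thesis
    unfolding P_set_def mem_Collect_eq
    using mem[OF assms(1)] mem[OF assms(2)] assms
    by (intro exI[of _ "sorted_list_of_multiset \<alpha>"] exI[of _ "sorted_list_of_multiset \<beta>"])
      (simp add: T_seq_sorted_list u_seq_sorted_list prod_u)
qed

text \<open>
  Induction on the common length of \<open>\<alpha>\<close> and \<open>\<beta>\<close>. The exponent \<open>a\<close> varies because an exchange step
  \<open>X\<^sup>a T\<^sub>i \<rightarrow> X\<^sup>c T\<^sub>j\<close> changes it, while \<open>b\<close> stays the same throughout.
\<close>
lemma binomial_mem:
  assumes I: "ideal I (R_ring n r)"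
    and K1: "rees_component n r J u 1 \<subseteq> I" and P: "\<And>s. s \<ge> 2 \<Longrightarrow> P_set r u s \<subseteq> I"
    and "set_mset \<alpha> \<subseteq> {1..r}" "set_mset \<beta> \<subseteq> {1..r}" "size \<alpha> = size \<beta>"
    and "Poly_Mapping.keys a \<subseteq> {1..n}" "Poly_Mapping.keys b \<subseteq> {1..n}"
    and "a + (\<Sum>j\<in>#\<alpha>. v j) = b + (\<Sum>j\<in>#\<beta>. v j)"
  shows "bimonomial a \<alpha> - bimonomial b \<beta> \<in> I"
  using assms(4-)
proof (induction "size \<alpha>" arbitrary: \<alpha> \<beta> a)
  case 0
  then have "\<alpha> = {#}" "\<beta> = {#}" by simp_all
  then show ?case using 0 ideal_ring_onD(2)[OF I[unfolded R_ring_eq]] by simp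
next
  case (Suc s)
  note closed = ideal_ring_onD[OF I[unfolded R_ring_eq]]
  show ?case
  proof (cases "a = b")
    case True
    have eq: "(\<Sum>j\<in>#\<alpha>. v j) = (\<Sum>j\<in>#\<beta>. v j)" using Suc.prems True by simp
    show ?thesis
    proof (cases "s = 0")
      \<comment> \<open>The fiber relations start in degree 2; in degree 1 the binomial is itself a linear relation.\<close>
      case False
      have "(\<Prod>j\<in>#\<alpha>. T_var j) - (\<Prod>j\<in>#\<beta>. T_var j) \<in> P_set r u (size \<alpha>)"
        by (rule fiber_relation_mem) (use Suc.prems eq in simp_all)
      then have "(\<Prod>j\<in>#\<alpha>. T_var j) - (\<Prod>j\<in>#\<beta>. T_var j) \<in> I"
        using P[of "size \<alpha>"] Suc.hyps(2) False by auto
      then have "Poly_Mapping.single 0 (Poly_Mapping.single b 1) * ((\<Prod>j\<in>#\<alpha>. T_var j) - (\<Prod>j\<in>#\<beta>. T_var j)) \<in> I"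
        using closed(4) coefficient_mem[of b n] Suc.prems by blast
      then show ?thesis by (simp add: True bimonomial_def right_diff_distrib)
    next
      case s: True
      then obtain i j where "\<alpha> = {#i#}" "\<beta> = {#j#}"
        using Suc.hyps(2) Suc.prems(3) by (metis One_nat_def size_1_singleton_mset)
      then show ?thesis using linear_relation_mem[of i j a b] Suc.prems K1 by auto
    qed
  next
    case False
    have in_r: "j \<in> {1..r}" if "j \<in># \<alpha> + \<beta>" for j
      using that Suc.prems by auto
    obtain i j c where ij: "i \<in># \<alpha>" "j \<in># \<beta>" and c: "a + v i = c + v j"
      using exchange_divides[of \<alpha> \<beta> v n a b] in_r keys_v v_le_1 deg_v Suc.prems False by metis
    obtain \<alpha>' \<beta>' where \<alpha>': "\<alpha> = add_mset i \<alpha>'" and \<beta>': "\<beta> = add_mset j \<beta>'"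
      using ij by (meson mset_add)
    have keys_c: "Poly_Mapping.keys c \<subseteq> {1..n}"
    proof -
      have "Poly_Mapping.keys c \<subseteq> Poly_Mapping.keys (a + v i)"
        unfolding c by (auto simp: in_keys_iff lookup_add)
      then show ?thesis using keys_add[of a "v i"] Suc.prems keys_v[of i] ij by blast
    qed
    have "c + (\<Sum>j\<in>#\<alpha>'. v j) + v j = b + (\<Sum>j\<in>#\<beta>'. v j) + v j"
    proof -
      have "c + (\<Sum>j\<in>#\<alpha>'. v j) + v j = (c + v j) + (\<Sum>j\<in>#\<alpha>'. v j)" by (simp add: ac_simps)
      also have "\<dots> = a + (\<Sum>j\<in>#\<alpha>. v j)" by (simp add: \<alpha>' ac_simps flip: c)
      also have "\<dots> = b + (\<Sum>j\<in>#\<beta>'. v j) + v j" using Suc.prems by (simp add: \<beta>' ac_simps)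
      finally show ?thesis .
    qed
    then have IH: "bimonomial c \<alpha>' - bimonomial b \<beta>' \<in> I"
      using Suc.hyps(2) Suc.prems keys_c by (intro Suc.hyps(1)) (auto simp: \<alpha>' \<beta>')
    have lin: "bimonomial a {#i#} - bimonomial c {#j#} \<in> I"
      using linear_relation_mem[of i j a c] K1 c ij Suc.prems by blast
    \<comment> \<open>Exchange \<open>T\<^sub>i\<close> for \<open>T\<^sub>j\<close>, then split off the common factor \<open>T\<^sub>j\<close>.\<close>
    have "bimonomial a \<alpha> - bimonomial b \<beta> =
        (\<Prod>j\<in>#\<alpha>'. T_var j) * (bimonomial a {#i#} - bimonomial c {#j#}) +
        T_var j * (bimonomial c \<alpha>' - bimonomial b \<beta>')"
      unfolding \<alpha>' \<beta>' right_diff_distrib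
      by (simp flip: bimonomial_add_mset bimonomial_add_mset')
    also have "\<dots> \<in> I"
      using lin IH in_r[of j] ij Suc.prems
      by (intro closed(3) closed(4) prod_T_var_mem T_var_mem) (auto simp: \<alpha>')
    finally show ?thesis .
  qed
qed

text \<open>
  Comparing the coefficients of each monomial \<open>X\<^sup>q t\<^sup>s\<close> in the vanishing image of \<open>P\<close> shows that the
  coefficients of the monomials of \<open>P\<close> with that image sum to zero.
\<close>
lemma rees_ideal_subset:
  assumes I: "ideal I (R_ring n r)"
    and K1: "rees_component n r J u 1 \<subseteq> I" and PI: "\<And>s. s \<ge> 2 \<Longrightarrow> P_set r u s \<subseteq> I"
  shows "rees_ideal n r J u \<subseteq> I"
proof
  fix P assume "P \<in> rees_ideal n r J u"
  then have P: "P \<in> bipolys n r" "rees_map u P = 0"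
    by (simp_all add: rees_ideal_eq R_ring_eq ring_on_def)
  define A where "A = (SIGMA m:Poly_Mapping.keys P. Poly_Mapping.keys (Poly_Mapping.lookup P m))"
  define c where "c = (\<lambda>(m, a). Poly_Mapping.lookup (Poly_Mapping.lookup P m) a)"
  define g where "g = (\<lambda>(m, a). bimonomial a (exponent_mset m) :: 'k mpoly mpoly)"
  define w where "w = (\<lambda>(m, a). (a + (\<Sum>j\<in>#exponent_mset m. v j), size (exponent_mset m)))"
  \<comment> \<open>\<open>A\<close> indexes the monomials \<open>g i\<close> of \<open>P\<close> with their coefficients \<open>c i\<close>; \<open>w i\<close> records the exponent
    vector in the \<open>X\<close> variables and the exponent of \<open>t\<close> of the image of \<open>g i\<close>.\<close>
  have expand: "P = (\<Sum>i\<in>A. scalar (c i) * g i)"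
    using eq_sum_bimonomials[of P] by (simp add: A_def c_def g_def split_def)
  have A: "Poly_Mapping.keys m \<subseteq> {1..r}" "Poly_Mapping.keys a \<subseteq> {1..n}" if "(m, a) \<in> A" for m a
    using that P(1) by (auto simp: A_def mpolys_over_def)
  have fin: "finite A" by (simp add: A_def)
  have image: "rees_map u (scalar (c i) * g i) =
      Polynomial.monom (Poly_Mapping.single (fst (w i)) (c i)) (snd (w i))" if "i \<in> A" for i
  proof (cases i)
    case (Pair m a)
    then have "set_mset (exponent_mset m) \<subseteq> {1..r}" using A(1) that by (simp add: set_exponent_mset)
    then show ?thesis
      by (simp add: Pair g_def w_def rees_map_mult rees_map_const rees_map_bimonomial smult_monom mult_single)
  qed
  have "(\<Sum>i\<in>{i \<in> A. w i = q}. c i) = 0" for q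
  proof -
    have "0 = Poly_Mapping.lookup (Polynomial.coeff (rees_map u P) (snd q)) (fst q)"
      using P(2) by simp
    also have "\<dots> = (\<Sum>i\<in>A. Poly_Mapping.lookup (Polynomial.coeff
        (Polynomial.monom (Poly_Mapping.single (fst (w i)) (c i)) (snd (w i))) (snd q)) (fst q))"
      by (subst expand) (simp add: rees_map_sum image coeff_sum lookup_sum)
    also have "\<dots> = (\<Sum>i\<in>A. if w i = q then c i else 0)"
      by (intro sum.cong) (auto simp: lookup_single when_def prod_eq_iff)
    also have "\<dots> = (\<Sum>i\<in>{i \<in> A. w i = q}. c i)"
      using fin by (simp add: sum.inter_filter)
    finally show ?thesis ..
  qed
  moreover have "g i - g j \<in> I" if "i \<in> A" "j \<in> A" "w i = w j" for i j
  proof -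
    obtain m a l b where ij: "i = (m, a)" "j = (l, b)" by (meson surj_pair)
    have "bimonomial a (exponent_mset m) - bimonomial b (exponent_mset l) \<in> I"
      using A that by (intro binomial_mem[OF I K1 PI]) (simp_all add: ij w_def set_exponent_mset)
    then show ?thesis by (simp add: ij g_def)
  qed
  moreover have "range scalar \<subseteq> bipolys n r"
    using coefficient_mem[of 0 n] by auto
  ultimately show "P \<in> I"
    unfolding expand using weighted_sum_mem_ideal[OF I[unfolded R_ring_eq] _ fin] by blast
qed

end

theorem proposition3p6:
  fixes n r :: nat
    and J :: "'k::field mpoly set"
    and u :: "nat \<Rightarrow> 'k mpoly"
  assumes "squarefree_monomial_ideal n J"
    and "inj_on u {1..r}"
    and "minimal_monomial_generators n J (u ` {1..r})"
    and "\<forall>j\<in>{1..r}. homogeneous (int n - 2) (u j)"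
  shows "rees_ideal n r J u =
    Idl\<^bsub>R_ring n r\<^esub> (rees_component n r J u 1) <+>\<^bsub>R_ring n r\<^esub>
    Idl\<^bsub>R_ring n r\<^esub> (\<Union>s\<in>{2..}. P_set r u s)"
proof -
  let ?R = "R_ring n r :: 'k mpoly mpoly ring" and ?K = "rees_ideal n r J u"
  let ?K1 = "rees_component n r J u 1" and ?P = "\<Union>s\<in>{2..}. P_set r u s"
  interpret cring ?R
    unfolding R_ring_eq by (rule cring_ring_on[OF ring_closed_bipolys])
  have KR: "?K \<subseteq> carrier ?R" by (auto simp: rees_ideal_eq)
  have K1: "?K1 \<subseteq> ?K" by (auto simp: rees_component_def)
  have P: "?P \<subseteq> ?K" using P_set_subset_rees_ideal by blast
  have ideals: "ideal (Idl\<^bsub>?R\<^esub> ?K1) ?R" "ideal (Idl\<^bsub>?R\<^esub> ?P) ?R"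
    using genideal_ideal K1 P KR by blast+
  define I where "I = Idl\<^bsub>?R\<^esub> ?K1 <+>\<^bsub>?R\<^esub> Idl\<^bsub>?R\<^esub> ?P"
  have I: "ideal I ?R" unfolding I_def using ideals by (rule add_ideals)
  have I_union: "I = Idl\<^bsub>?R\<^esub> (Idl\<^bsub>?R\<^esub> ?K1 \<union> Idl\<^bsub>?R\<^esub> ?P)"
    unfolding I_def using union_genideal[OF ideals] by simp
  have "?K1 \<subseteq> Idl\<^bsub>?R\<^esub> ?K1" "?P \<subseteq> Idl\<^bsub>?R\<^esub> ?P"
    using genideal_self K1 P KR by blast+
  moreover have "Idl\<^bsub>?R\<^esub> ?K1 \<union> Idl\<^bsub>?R\<^esub> ?P \<subseteq> I"
    unfolding I_union using ideals by (intro genideal_self) (auto dest: ideal.Icarr)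
  ultimately have gens: "?K1 \<subseteq> I" "?P \<subseteq> I" by blast+
  have "\<forall>j\<in>{1..r}. \<exists>m. u j = Poly_Mapping.single m 1 \<and> Poly_Mapping.keys m \<subseteq> {1..n} \<and>
      (\<forall>x. Poly_Mapping.lookup m x \<le> 1)"
    using equigenerated_generators_squarefree[OF assms(1,3,4)]
    unfolding squarefree_monomials_def by blast
  then obtain v where v: "\<And>j. j \<in> {1..r} \<Longrightarrow> u j = Poly_Mapping.single (v j) 1 \<and>
      Poly_Mapping.keys (v j) \<subseteq> {1..n} \<and> (\<forall>x. Poly_Mapping.lookup (v j) x \<le> 1)"
    by metis
  interpret codim2_monomials n r u v
  proof
    show "int (exp_deg (v j)) = int n - 2" if "j \<in> {1..r}" for j
      using assms(4) v[OF that] that by (auto simp: homogeneous_def)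
  qed (use v in auto)
  have "?K \<subseteq> I" using rees_ideal_subset[OF I gens(1)] gens(2) by blast
  moreover have "I \<subseteq> ?K"
    unfolding I_union using K1 P genideal_minimal[OF ideal_rees_ideal]
    by (intro genideal_minimal[OF ideal_rees_ideal]) blast
  ultimately show ?thesis unfolding I_def by blast
qed

end
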